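(* Let $X=(0,1]$ be the unit circle, $T(x)=x+\alpha\pmod 1$, $\mu$ the Lebesgue measure on $X$, and let $\mathcal{Z}$ be the partition of $X$ into $A_0=(0,1/2]$ and $A_1=(1/2,1]$. For all $\alpha\in\mathbb{R}\setminus\mathbb{Q}$ and for $\mu$-almost all $x\in X$ we have $AIC(x,n)\approx\text{constant}$, where the AIC is taken with respect to $\mathcal{Z}$.
   Context: Algorithmic information content: let $M_1,M_2,\dots$ be a computable enumeration of the Turing machines and $e_n$ the $n$-th binary string in lexicographical order $0,1,00,01,\dots$. Fix a universal Turing machine $U$, i.e. one with $U(\hat e_n p)=M_n(p)$ for all $n$ and all finite binary strings $p$, where for a word $q$ of length $m$, $\hat q=q(0)q(0)q(1)q(1)\cdots q(m-1)q(m-1)01$. For a finite string $s$ over a finite alphabet, $AIC_U(s)=\min\{\ell(p):U(p)=s\}$ over finite binary strings $p$, with $\ell(p)$ the length of $p$ (and $\infty$ if there is no such $p$). With $\omega_j\in\{0,1\}$ defined by $T^jx\in A_{\omega_j}$, put $AIC(x,n)=AIC_U(\omega_0\cdots\omega_{n-1})$. For sequences, $a_n\approx b_n$ means that for every $\epsilon>0$, $a_n/b_n=o(n^\epsilon)$ and $b_n/a_n=o(n^\epsilon)$ as $n\to\infty$. *)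

theory Defs
  imports
    "HOL-Analysis.Analysis"
    "HOL-Library.Nat_Bijection"
    "HOL-Library.While_Combinator"
    "HOL-Library.Landau_Symbols"
begin

text \<open>Binary strings are lists over \<^typ>\<open>bool\<close>, with \<^term>\<open>True\<close> standing for the digit 1.\<close>

section \<open>Turing machines\<close>

text \<open>Deterministic machines with one two-way infinite tape. Every machine uses finitely many
  of the working symbols \<open>Mark k\<close>.\<close>

datatype symbol = Blank | Digit bool | Mark nat

datatype move = Left | Stay | Right

text \<open>A machine is its finite transition table: in state \<open>q\<close> scanning \<open>s\<close>, the entry
  \<open>((q, s), (q', s', d))\<close> writes \<open>s'\<close>, moves by \<open>d\<close> and enters state \<open>q'\<close>. As usual for
  association lists, the first entry for \<open>(q, s)\<close> counts. The machine halts when no entry applies.\<close>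

type_synonym tm = "((nat \<times> symbol) \<times> (nat \<times> symbol \<times> move)) list"

text \<open>State, position of the head, tape.\<close>

type_synonym config = "nat \<times> int \<times> (int \<Rightarrow> symbol)"

fun shift :: "move \<Rightarrow> int" where
  "shift Left = - 1"
| "shift Stay = 0"
| "shift Right = 1"

fun halted :: "tm \<Rightarrow> config \<Rightarrow> bool" where
  "halted M (q, h, t) \<longleftrightarrow> map_of M (q, t h) = None"

fun step :: "tm \<Rightarrow> config \<Rightarrow> config" where
  "step M (q, h, t) =
    (case map_of M (q, t h) of
      None \<Rightarrow> (q, h, t)
    | Some (q', s', d) \<Rightarrow> (q', h + shift d, t(h := s')))"

definition initial :: "bool list \<Rightarrow> config" where
  "initial p = (0, 0, \<lambda>i. if 0 \<le> i \<and> i < int (length p) then Digit (p ! nat i) else Blank)"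

text \<open>The output is the maximal block of digits that starts at the scanned cell.\<close>

fun tape_output :: "config \<Rightarrow> bool list" where
  "tape_output (q, h, t) =
    map (\<lambda>i. t (h + int i) = Digit True)
      [0..<(LEAST n. t (h + int n) \<notin> range Digit)]"

text \<open>The partial function on binary strings computed by a machine; \<^term>\<open>None\<close> if it does not
  halt.\<close>

definition tm_fun :: "tm \<Rightarrow> bool list \<Rightarrow> bool list option" where
  "tm_fun M p = map_option tape_output (while_option (\<lambda>c. \<not> halted M c) (step M) (initial p))"

section \<open>Enumerations and universal machines\<close>

text \<open>For \<open>n \<ge> 1\<close> this is the \<open>n\<close>-th string in the list 0, 1, 00, 01, 10, 11, 000, \dots (bijective
  base 2); the lemmas below confirm the order and that every string occurs.
  The empty string gets the index 0.\<close>

fun nth_string :: "nat \<Rightarrow> bool list" where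
  "nth_string n = (if n = 0 then [] else nth_string ((n - 1) div 2) @ [even n])"

declare nth_string.simps [simp del]

lemma nth_string_0: "nth_string 0 = []"
  by (simp add: nth_string.simps)

lemma nth_string_strict_mono:
  "m < n \<Longrightarrow> (nth_string m, nth_string n) \<in> lenlex {(False, True)}"
proof (induction n arbitrary: m rule: less_induct)
  case (less n)
  have n: "nth_string n = nth_string ((n - 1) div 2) @ [even n]"
    using less.prems by (simp add: nth_string.simps [of n])
  show ?case
  proof (cases "m = 0")
    case True
    then show ?thesis by (simp add: n nth_string_0 lenlex_conv)
  next
    case False
    then have m: "nth_string m = nth_string ((m - 1) div 2) @ [even m]"
      by (simp add: nth_string.simps [of m])
    show ?thesis
    proof (cases "(m - 1) div 2 = (n - 1) div 2")
      case True
      then have "odd m" "even n" using False less.prems by presburger+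
      then show ?thesis
        unfolding m n True lenlex_conv by (auto intro: lex_append_leftI)
    next
      case False
      then have "(m - 1) div 2 < (n - 1) div 2" using less.prems
        by (metis diff_le_mono div_le_mono le_neq_implies_less less_imp_le)
      then have "(nth_string ((m - 1) div 2), nth_string ((n - 1) div 2)) \<in> lenlex {(False, True)}"
        using less.prems by (intro less.IH) auto
      then show ?thesis
        by (auto simp add: m n lenlex_conv intro: lex_append_rightI)
    qed
  qed
qed

lemma nth_string_surj: "\<exists>n. nth_string n = w"
proof (induction w rule: rev_induct)
  case Nil
  show ?case using nth_string_0 by blast
next
  case (snoc b w)
  then obtain k where k: "nth_string k = w" by blast
  have "nth_string (2 * k + (if b then 2 else 1)) = w @ [b]"
    using k by (subst nth_string.simps) auto
  then show ?case by blast
qed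

definition hat :: "bool list \<Rightarrow> bool list" where
  "hat q = concat (map (\<lambda>b. [b, b]) q) @ [False, True]"

text \<open>A concrete numbering of the machines, through which a machine can be the output of a
  computation.\<close>

fun symbol_number :: "symbol \<Rightarrow> nat" where
  "symbol_number Blank = 0"
| "symbol_number (Digit b) = (if b then 2 else 1)"
| "symbol_number (Mark k) = k + 3"

fun move_number :: "move \<Rightarrow> nat" where
  "move_number Left = 0"
| "move_number Stay = 1"
| "move_number Right = 2"

definition tm_number :: "tm \<Rightarrow> nat" where
  "tm_number M =
    list_encode
      (map (\<lambda>((q, s), (q', s', d)).
          prod_encode (prod_encode (q, symbol_number s),
            prod_encode (q', prod_encode (symbol_number s', move_number d)))) M)"

text \<open>Indices start at 1; the value of an enumeration at 0 is irrelevant.\<close>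

definition computable_enumeration :: "(nat \<Rightarrow> tm) \<Rightarrow> bool" where
  "computable_enumeration M \<longleftrightarrow>
    M ` {1..} = UNIV \<and>
    (\<exists>C. \<forall>n\<ge>1. tm_fun C (nth_string n) = Some (nth_string (tm_number (M n))))"

text \<open>The equation is between partial functions: one side is undefined iff the other is.\<close>

definition universal :: "(nat \<Rightarrow> tm) \<Rightarrow> tm \<Rightarrow> bool" where
  "universal M U \<longleftrightarrow> (\<forall>n\<ge>1. \<forall>p. tm_fun U (hat (nth_string n) @ p) = tm_fun (M n) p)"

section \<open>Algorithmic information content\<close>

text \<open>In \<^typ>\<open>enat\<close> the infimum of a nonempty set is its minimum, that of the empty set is
  \<open>\<infinity>\<close>.\<close>

definition AIC_string :: "tm \<Rightarrow> bool list \<Rightarrow> enat" where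
  "AIC_string U s = (INF p \<in> {p. tm_fun U p = Some s}. enat (length p))"

text \<open>A partition into two sets is a family indexed by the digits.\<close>

definition itinerary :: "(real \<Rightarrow> real) \<Rightarrow> (bool \<Rightarrow> real set) \<Rightarrow> real \<Rightarrow> nat \<Rightarrow> bool" where
  "itinerary T A x j = (THE b. (T ^^ j) x \<in> A b)"

definition AIC :: "tm \<Rightarrow> (real \<Rightarrow> real) \<Rightarrow> (bool \<Rightarrow> real set) \<Rightarrow> real \<Rightarrow> nat \<Rightarrow> enat" where
  "AIC U T A x n = AIC_string U (map (itinerary T A x) [0..<n])"

section \<open>Growth of sequences\<close>

text \<open>Extended reals, because the information content may be infinite. In \<^typ>\<open>ereal\<close> a
  positive number divided by 0 is \<open>\<infinity>\<close>, so undefined quotients do not count as small. On real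
  sequences the following is the usual relation, by the lemma.\<close>

definition little_o :: "(nat \<Rightarrow> ereal) \<Rightarrow> (nat \<Rightarrow> real) \<Rightarrow> bool" where
  "little_o f g \<longleftrightarrow> (\<lambda>n. f n / ereal (g n)) \<longlonglongrightarrow> 0"

lemma little_o_ereal_iff:
  assumes "\<forall>\<^sub>F n in sequentially. g n \<noteq> 0"
  shows "little_o (\<lambda>n. ereal (f n)) g \<longleftrightarrow> f \<in> o(g)"
proof -
  have "little_o (\<lambda>n. ereal (f n)) g \<longleftrightarrow> (\<lambda>n. ereal (f n / g n)) \<longlonglongrightarrow> ereal 0"
    unfolding little_o_def zero_ereal_def using assms
    by (intro filterlim_cong refl) (auto elim!: eventually_mono)
  also have "\<dots> \<longleftrightarrow> (\<lambda>n. f n / g n) \<longlonglongrightarrow> 0"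
    by simp
  also have "\<dots> \<longleftrightarrow> f \<in> o(g)"
    using assms smalloI_tendsto smalloD_tendsto by blast
  finally show ?thesis .
qed

definition approx_seq :: "(nat \<Rightarrow> ereal) \<Rightarrow> (nat \<Rightarrow> ereal) \<Rightarrow> bool" where
  "approx_seq a b \<longleftrightarrow>
    (\<forall>\<epsilon>>0. little_o (\<lambda>n. a n / b n) (\<lambda>n. real n powr \<epsilon>) \<and>
           little_o (\<lambda>n. b n / a n) (\<lambda>n. real n powr \<epsilon>))"

section \<open>The rotation\<close>

text \<open>\<open>y - \<lceil>y\<rceil> + 1\<close> is the representative of \<open>y\<close> modulo 1 in \<open>(0, 1]\<close>.\<close>

definition rotation :: "real \<Rightarrow> real \<Rightarrow> real" where
  "rotation \<alpha> x = x + \<alpha> - of_int \<lceil>x + \<alpha>\<rceil> + 1"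

definition halves :: "bool \<Rightarrow> real set" where
  "halves b = (if b then {1/2<..1} else {0<..1/2})"

end

theory Submission
  imports Defs "HOL-Real_Asymp.Real_Asymp"
begin

text \<open>For almost every \<open>x\<close> the orbit point \<open>x + j\<alpha>\<close> stays at distance at least a constant times
  \<open>1/(j + 1)\<^sup>2\<close> from the endpoints of the partition, by the Borel--Cantelli lemma. The first \<open>n\<close>
  digits of the itinerary are therefore unchanged when \<open>x\<close> and \<open>\<alpha>\<close> are rounded to dyadic numbers
  with \<open>O(log n)\<close> bits. The digits are then the leading bits in an arithmetic progression modulo
  \<open>2\<^sup>L\<close>, which one Turing machine generates from the starting value, the increment and \<open>n\<close>. A
  universal machine simulates it at constant cost, so the information content is \<open>O(log n)\<close>; it
  vanishes for at most one \<open>n\<close>.\<close>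

section \<open>A machine generating arithmetic progressions modulo a power of two\<close>

text \<open>This allows a transition table to be specified as a partial function with finite
  domain.\<close>

lemma finite_dom_map_of_ex:
  assumes "finite (dom m)"
  shows "\<exists>xs. map_of xs = m"
  using assms
proof (induction "dom m" arbitrary: m rule: finite_induct)
  case empty
  then show ?case by (metis dom_eq_empty_conv map_of.simps(1))
next
  case (insert x F)
  then have "F = dom (m(x := None))" by auto
  then obtain xs where xs: "map_of xs = m(x := None)" using insert by blast
  obtain y where "m x = Some y" using insert by blast
  then have "map_of ((x, y) # xs) = m" by (simp add: xs fun_upd_idem_iff)
  then show ?case ..
qed

section \<open>Tapes as pairs of lists\<close>

definition cell :: "symbol list \<Rightarrow> nat \<Rightarrow> symbol" where
  "cell xs k = (if k < length xs then xs ! k else Blank)"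

lemma cell_Cons_0: "cell (x # xs) 0 = x"
  and cell_Cons_Suc: "cell (x # xs) (Suc k) = cell xs k"
  by (simp_all add: cell_def)

text \<open>\<open>ls\<close> lists the cells left of the head, nearest first, and \<open>rs\<close>
  begins with the scanned cell, so a move of the head transfers one element between the
  lists.\<close>

definition tape :: "int \<Rightarrow> symbol list \<Rightarrow> symbol list \<Rightarrow> int \<Rightarrow> symbol" where
  "tape h ls rs i = (if i < h then cell ls (nat (h - 1 - i)) else cell rs (nat (i - h)))"

lemma tape_head: "tape h ls (s # rs) h = s"
  by (simp add: tape_def cell_def)

lemma tape_right: "(tape h ls (s # rs))(h := s') = tape (h + 1) (s' # ls) rs"
proof
  fix i
  consider "i < h" | "i = h" | "i > h" by linarith
  then show "((tape h ls (s # rs))(h := s')) i = tape (h + 1) (s' # ls) rs i"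
  proof cases
    case 1
    then have "nat (h - i) = Suc (nat (h - 1 - i))" by simp
    then show ?thesis using 1 by (simp add: tape_def cell_Cons_Suc)
  next
    case 2
    then show ?thesis by (simp add: tape_def cell_Cons_0)
  next
    case 3
    then have "nat (i - h) = Suc (nat (i - (h + 1)))" by simp
    then show ?thesis using 3 by (simp add: tape_def cell_Cons_Suc)
  qed
qed

text \<open>A right move that rewrites the scanned symbol unchanged leaves the tape as it is, so
  three instances of \<open>tape_right\<close> combine to a left move.\<close>

lemma tape_left: "(tape h (x # ls) (s # rs))(h := s') = tape (h - 1) ls (x # s' # rs)"
  using tape_right [of "h - 1" ls x "s' # rs" x] tape_right [of h "x # ls" s rs s']
    tape_right [of h "x # ls" s' rs s']
  by (metis diff_add_cancel fun_upd_triv tape_head)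

lemma tape_Blank: "tape h [Blank] rs = tape h [] rs" "tape h ls [Blank] = tape h ls []"
  by (auto simp: fun_eq_iff tape_def cell_def)

text \<open>The work area holds triples of digits, least significant first: one digit each of the counter,
  the increment \<open>b\<close> and the accumulator \<open>a\<close>. A rightward sweep replaces \<open>a\<close> by \<open>a + b\<close> modulo
  \<open>2\<^sup>L\<close> and decrements the counter; then the top digit of \<open>a\<close> is appended to the output, which is
  separated from the work area by a blank. In the states, \<open>k\<close> is the carry of the addition, \<open>l\<close> the
  last accumulator digit, and \<open>nb\<close> says that the decrement no longer borrows; a borrow at the end
  of the sweep means that the counter was 0, and the machine halts. \<open>Return f\<close> has passed the
  separator iff \<open>f\<close>.\<close>

datatype state = Counter bool bool bool | Increment bool bool | Accumulator bool bool bool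
  | Emit bool | Return bool | Done

text \<open>Consecutive blocks of codes. \<open>Counter False False False\<close> gets 0 because
  \<open>initial\<close> starts in state 0.\<close>

fun state_number :: "state \<Rightarrow> nat" where
  "state_number (Counter k l nb) = of_bool k + 2 * of_bool l + 4 * of_bool nb"
| "state_number (Increment k nb) = 8 + of_bool k + 2 * of_bool nb"
| "state_number (Accumulator k b nb) = 12 + of_bool k + 2 * of_bool b + 4 * of_bool nb"
| "state_number (Emit l) = 20 + of_bool l"
| "state_number (Return f) = 22 + of_bool f"
| "state_number Done = 24"

lemma inj_state_number: "inj state_number"
proof (rule inj_on_inverseI)
  define decode where "decode = (\<lambda>n::nat. if n < 8 then Counter (odd n) (odd (n div 2)) (odd (n div 4))
    else if n < 12 then Increment (odd n) (odd (n div 2))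
    else if n < 20 then Accumulator (odd (n - 12)) (odd ((n - 12) div 2)) (odd ((n - 12) div 4))
    else if n < 22 then Emit (odd n) else if n < 24 then Return (odd n) else Done)"
  fix q
  show "decode (state_number q) = q"
  proof (cases q)
    case (Counter k l nb)
    then show ?thesis by (cases k; cases l; cases nb) (simp_all add: decode_def)
  next
    case (Increment k nb)
    then show ?thesis by (cases k; cases nb) (simp_all add: decode_def)
  next
    case (Accumulator k b nb)
    then show ?thesis by (cases k; cases b; cases nb) (simp_all add: decode_def)
  next
    case (Emit l)
    then show ?thesis by (cases l) (simp_all add: decode_def)
  next
    case (Return f)
    then show ?thesis by (cases f) (simp_all add: decode_def)
  qed (simp add: decode_def)
qed

lemma state_number_le: "state_number q \<le> 24"
  by (cases q) (auto simp: of_bool_def)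

fun carry :: "bool \<Rightarrow> bool \<Rightarrow> bool \<Rightarrow> bool" where
  "carry k b a = (if k then a \<or> b else a \<and> b)"

text \<open>Two nested equivalences of three bits form their exclusive or: the sum digit of the full
  adder whose carry is \<open>carry\<close>.\<close>

fun parity :: "bool \<Rightarrow> bool \<Rightarrow> bool \<Rightarrow> bool" where
  "parity k b a = (k = (b = a))"

text \<open>The borrow of the decrement is \<open>\<not> nb\<close>; hence the new digit is
  \<open>c = nb\<close>, and the first digit 1 ends the borrow. The blank that
  \<open>Return True\<close> meets lies just left of the work area.\<close>

fun transition :: "state \<Rightarrow> symbol \<Rightarrow> (state \<times> symbol \<times> move) option" where
  "transition (Counter k l nb) (Digit c) = Some (Increment k (nb \<or> c), Digit (c = nb), Right)"
| "transition (Increment k nb) (Digit b) = Some (Accumulator k b nb, Digit b, Right)"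
| "transition (Accumulator k b nb) (Digit a) =
    Some (Counter (carry k b a) (parity k b a) nb, Digit (parity k b a), Right)"
| "transition (Counter k l nb) Blank = Some (if nb then Emit l else Done, Blank, Right)"
| "transition (Emit l) (Digit d) = Some (Emit l, Digit d, Right)"
| "transition (Emit l) Blank = Some (Return False, Digit l, Left)"
| "transition (Return f) (Digit d) = Some (Return f, Digit d, Left)"
| "transition (Return False) Blank = Some (Return True, Blank, Left)"
| "transition (Return True) Blank = Some (Counter False False False, Blank, Right)"
| "transition _ _ = None"

definition decodes :: "tm \<Rightarrow> bool" where
  "decodes D \<longleftrightarrow> (\<forall>q s. map_of D (state_number q, s) =
    map_option (\<lambda>(q', s', d). (state_number q', s', d)) (transition q s))"

text \<open>There are at most 25 state numbers, and only the blank and the two digits have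
  transitions, so the table is finite.\<close>

lemma decodes_ex: "\<exists>D. decodes D"
proof -
  define m where "m = (\<lambda>(n, s). if n \<in> range state_number then
    map_option (\<lambda>(q', s', d). (state_number q', s', d)) (transition (inv state_number n) s)
    else None)"
  have "transition q s \<noteq> None \<Longrightarrow> s \<in> {Blank, Digit True, Digit False}" for q s
    by (induction q s rule: transition.induct) auto
  then have "dom m \<subseteq> {..24} \<times> {Blank, Digit True, Digit False}"
    using state_number_le by (fastforce simp: m_def split: if_splits)
  then have "finite (dom m)" by (rule finite_subset) simp
  then obtain D where "map_of D = m" using finite_dom_map_of_ex by blast
  then have "decodes D" by (simp add: decodes_def m_def inj_state_number)
  then show ?thesis ..
qed

section \<open>Runs of the machine\<close>

definition conf :: "state \<Rightarrow> int \<Rightarrow> symbol list \<Rightarrow> symbol list \<Rightarrow> config" where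
  "conf q h ls rs = (state_number q, h, tape h ls rs)"

lemma conf_Blank: "conf q h [Blank] rs = conf q h [] rs" "conf q h ls [Blank] = conf q h ls []"
  by (simp_all add: conf_def tape_Blank)

abbreviation runs :: "tm \<Rightarrow> config \<Rightarrow> config \<Rightarrow> bool" where
  "runs D \<equiv> (\<lambda>c c'. c' = step D c)\<^sup>*\<^sup>*"

lemma step_halted: "halted D c \<Longrightarrow> step D c = c"
  by (cases c) simp

text \<open>\<open>step\<close> fixes halted configurations, so the idle steps that
  \<open>runs\<close> permits do not change where the loop stops.\<close>

lemma runs_while_option:
  assumes "runs D c c'" and "halted D c'"
  shows "while_option (\<lambda>c. \<not> halted D c) (step D) c = Some c'"
  using assms(1)
proof (induction rule: converse_rtranclp_induct)
  case base
  then show ?case using assms(2) by (subst while_option_unfold) simp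
next
  case (step c d)
  then show ?case
    by (cases "halted D c") (metis step_halted, simp add: while_option_unfold [of _ _ c])
qed

text \<open>A step is prefixed to a given run, so that runs are built from their final configuration
  back to their start.\<close>

lemma runs_right:
  assumes "decodes D" and "transition q s = Some (q', s', Right)"
    and "runs D (conf q' (h + 1) (s' # ls) rs) c"
  shows "runs D (conf q h ls (s # rs)) c"
proof -
  have "step D (conf q h ls (s # rs)) = conf q' (h + 1) (s' # ls) rs"
    using assms(1,2) by (simp add: decodes_def conf_def tape_head tape_right)
  then show ?thesis using assms(3) by (simp add: converse_rtranclp_into_rtranclp)
qed

lemma runs_left:
  assumes "decodes D" and "transition q s = Some (q', s', Left)"
    and "runs D (conf q' (h - 1) ls (x # s' # rs)) c"
  shows "runs D (conf q h (x # ls) (s # rs)) c"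
proof -
  have "step D (conf q h (x # ls) (s # rs)) = conf q' (h - 1) ls (x # s' # rs)"
    using assms(1,2) by (simp add: decodes_def conf_def tape_head tape_left)
  then show ?thesis using assms(3) by (simp add: converse_rtranclp_into_rtranclp)
qed

section \<open>One round: sweep, output, return\<close>

type_synonym register = "(bool \<times> bool \<times> bool) list"

fun cells :: "register \<Rightarrow> bool list" where
  "cells [] = []"
| "cells ((c, b, a) # gs) = c # b # a # cells gs"

fun sweep :: "bool \<Rightarrow> bool \<Rightarrow> register \<Rightarrow> register" where
  "sweep k nb [] = []"
| "sweep k nb ((c, b, a) # gs) =
    (c = nb, b, parity k b a) # sweep (carry k b a) (nb \<or> c) gs"

definition counter :: "register \<Rightarrow> bool list" where
  "counter = map fst"

definition increment :: "register \<Rightarrow> bool list" where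
  "increment = map (fst \<circ> snd)"

definition accumulator :: "register \<Rightarrow> bool list" where
  "accumulator = map (snd \<circ> snd)"

lemmas register_defs = counter_def increment_def accumulator_def

lemma length_cells: "length (cells gs) = 3 * length gs"
  by (induction gs rule: cells.induct) auto

lemma length_sweep: "length (sweep k nb gs) = length gs"
  by (induction k nb gs rule: sweep.induct) auto

text \<open>Each triple costs three transitions. The final carry \<open>k'\<close> is left
  unspecified because addition modulo a power of two discards it.\<close>

lemma runs_sweep:
  assumes "decodes D"
  shows "\<exists>k'. runs D
    (conf (Counter k l nb) h ls (map Digit (cells gs) @ rs))
    (conf (Counter k' (last (l # accumulator (sweep k nb gs))) (nb \<or> True \<in> set (counter gs)))
      (h + 3 * int (length gs)) (map Digit (rev (cells (sweep k nb gs))) @ ls) rs)"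
proof (induction k nb gs arbitrary: l h ls rule: sweep.induct)
  case (1 k nb)
  then show ?case by (auto simp: register_defs)
next
  case (2 k nb c b a gs)
  obtain k' where "runs D
    (conf (Counter (carry k b a) (parity k b a) (nb \<or> c)) (h + 3)
      (Digit (parity k b a) # Digit b # Digit (c = nb) # ls) (map Digit (cells gs) @ rs))
    (conf (Counter k' (last (parity k b a # accumulator (sweep (carry k b a) (nb \<or> c) gs)))
        ((nb \<or> c) \<or> True \<in> set (counter gs)))
      (h + 3 + 3 * int (length gs))
      (map Digit (rev (cells (sweep (carry k b a) (nb \<or> c) gs)))
        @ Digit (parity k b a) # Digit b # Digit (c = nb) # ls) rs)"
    using "2.IH" by blast
  \<comment> \<open>The head position is written as three increments to match three uses of
    \<open>runs_right\<close>.\<close>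
  then have "runs D
    (conf (Counter (carry k b a) (parity k b a) (nb \<or> c)) (h + 1 + 1 + 1)
      (Digit (parity k b a) # Digit b # Digit (c = nb) # ls) (map Digit (cells gs) @ rs))
    (conf (Counter k' (last (l # accumulator (sweep k nb ((c, b, a) # gs))))
        (nb \<or> True \<in> set (counter ((c, b, a) # gs))))
      (h + 3 * int (length ((c, b, a) # gs)))
      (map Digit (rev (cells (sweep k nb ((c, b, a) # gs)))) @ ls) rs)"
    by (simp add: register_defs algebra_simps del: carry.simps parity.simps)
  then have "runs D (conf (Counter k l nb) h ls (Digit c # Digit b # Digit a # map Digit (cells gs) @ rs))
    (conf (Counter k' (last (l # accumulator (sweep k nb ((c, b, a) # gs))))
        (nb \<or> True \<in> set (counter ((c, b, a) # gs))))
      (h + 3 * int (length ((c, b, a) # gs)))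
      (map Digit (rev (cells (sweep k nb ((c, b, a) # gs)))) @ ls) rs)"
    by (intro runs_right [OF assms transition.simps(1)] runs_right [OF assms transition.simps(2)]
         runs_right [OF assms transition.simps(3)])
  then show ?case by (intro exI [of _ k']) (simp only: cells.simps list.map append_Cons)
qed

lemma runs_Emit:
  assumes "decodes D"
  shows "runs D (conf (Emit l) (h + int (length out)) (map Digit (rev out) @ ls) rs) c \<Longrightarrow>
    runs D (conf (Emit l) h ls (map Digit out @ rs)) c"
proof (induction out arbitrary: h ls)
  case (Cons d out)
  have "runs D (conf (Emit l) (h + 1) (Digit d # ls) (map Digit out @ rs)) c"
    using Cons.prems by (intro Cons.IH) (simp add: algebra_simps)
  then show ?case by (simp add: runs_right [OF assms transition.simps(5)])
qed simp

text \<open>For leftward passes the scanned symbol is the first element of the left list.\<close>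

definition left_conf :: "state \<Rightarrow> int \<Rightarrow> symbol list \<Rightarrow> symbol list \<Rightarrow> config" where
  "left_conf q h ls rs = conf q h (tl ls) (hd ls # rs)"

lemma runs_left_conf:
  assumes "decodes D" and "transition q s = Some (q', s', Left)" and "ls \<noteq> []"
    and "runs D (left_conf q' (h - 1) ls (s' # rs)) c"
  shows "runs D (left_conf q h (s # ls) rs) c"
  using assms runs_left [OF assms(1,2), of h "tl ls" "hd ls" rs c]
  by (simp add: left_conf_def)

lemma runs_Return:
  assumes "decodes D" and "ls \<noteq> []"
  shows "runs D (left_conf (Return f) (h - int (length out)) ls (map Digit (rev out) @ rs)) c \<Longrightarrow>
    runs D (left_conf (Return f) h (map Digit out @ ls) rs) c"
proof (induction out arbitrary: h rs)
  case (Cons d out)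
  have "runs D (left_conf (Return f) (h - 1) (map Digit out @ ls) (Digit d # rs)) c"
    using Cons.prems by (intro Cons.IH) (simp add: algebra_simps)
  then show ?case
    using assms(2) by (simp add: runs_left_conf [OF assms(1) transition.simps(7)])
qed simp

text \<open>The list \<open>[Blank]\<close> describes the same tape as \<open>[]\<close>; it
  exhibits the cell on which the return pass turns around.\<close>

definition work_conf :: "register \<Rightarrow> bool list \<Rightarrow> config" where
  "work_conf gs out = conf (Counter False False False) 0 [Blank]
     (map Digit (cells gs) @ Blank # map Digit out)"

text \<open>The phases appear in reverse order of time: turning around, return over the work area,
  return over the output, emission. The sweep is put in front at the end.\<close>

lemma runs_round:
  assumes D: "decodes D" and c: "True \<in> set (counter gs)" and "gs \<noteq> []"
  defines "gs' \<equiv> sweep False False gs"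
  shows "runs D (work_conf gs out) (work_conf gs' (out @ [last (accumulator gs')]))"
proof -
  define l where "l = last (accumulator gs')"
  define n where "n = int (length (cells gs'))"
  have n: "n = 3 * int (length gs)"
    by (simp add: n_def gs'_def length_cells length_sweep)
  have "accumulator gs' \<noteq> []"
    using assms(3) by (metis gs'_def accumulator_def length_0_conv length_map length_sweep)
  then have l: "last (False # accumulator gs') = l" by (simp add: l_def)
  let ?c = "work_conf gs' (out @ [l])"
  have "runs D (conf (Counter False False False) (- 1 + 1) [Blank]
      (map Digit (cells gs') @ Blank # map Digit (out @ [l]))) ?c"
    by (simp add: work_conf_def)
  then have "runs D (conf (Return True) (- 1) []
      (Blank # map Digit (cells gs') @ Blank # map Digit (out @ [l]))) ?c"
    by (rule runs_right [OF D transition.simps(9)])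
  then have "runs D (left_conf (Return True) (n - 1 - int (length (rev (cells gs')))) [Blank]
      (map Digit (rev (rev (cells gs'))) @ Blank # map Digit (out @ [l]))) ?c"
    by (simp add: left_conf_def n_def)
  then have "runs D (left_conf (Return True) (n - 1) (map Digit (rev (cells gs')) @ [Blank])
      (Blank # map Digit (out @ [l]))) ?c"
    by (rule runs_Return [OF D, rotated]) simp
  then have "runs D (left_conf (Return False) n (Blank # map Digit (rev (cells gs')) @ [Blank])
      (map Digit (out @ [l]))) ?c"
    by (intro runs_left_conf [OF D transition.simps(8)]) simp_all
  then have "runs D (left_conf (Return False) (n + int (length out)
      - int (length (rev out))) (Blank # map Digit (rev (cells gs')) @ [Blank])
      (map Digit (rev (rev out)) @ [Digit l])) ?c"
    by simp
  then have "runs D (left_conf (Return False) (n + int (length out))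
      (map Digit (rev out) @ Blank # map Digit (rev (cells gs')) @ [Blank]) [Digit l]) ?c"
    by (rule runs_Return [OF D, rotated]) simp
  then have "runs D (left_conf (Emit l) (n + int (length out) + 1)
      (Blank # map Digit (rev out) @ Blank # map Digit (rev (cells gs')) @ [Blank]) []) ?c"
    by (intro runs_left_conf [OF D transition.simps(6)]) simp_all
  then have "runs D (conf (Emit l) (n + 1 + int (length out))
      (map Digit (rev out) @ Blank # map Digit (rev (cells gs')) @ [Blank]) []) ?c"
    by (simp add: left_conf_def conf_Blank algebra_simps)
  then have "runs D (conf (Emit l) (n + 1) (Blank # map Digit (rev (cells gs')) @ [Blank])
      (map Digit out @ [])) ?c"
    by (rule runs_Emit [OF D])
  then have 1: "runs D (conf (Counter k l True) n (map Digit (rev (cells gs')) @ [Blank])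
      (Blank # map Digit out)) ?c" for k
    by (intro runs_right [OF D transition.simps(4)]) simp
  obtain k where 2: "runs D (work_conf gs out)
      (conf (Counter k l True) n (map Digit (rev (cells gs')) @ [Blank]) (Blank # map Digit out))"
    using runs_sweep [OF D, of False False False 0 "[Blank]" gs "Blank # map Digit out"] c l
    unfolding gs'_def [symmetric] work_conf_def n by auto
  show ?thesis unfolding l_def [symmetric] by (rule rtranclp_trans [OF 2 1])
qed

text \<open>With a zero counter the borrow survives the sweep, so the machine crosses the separator
  into \<open>Done\<close> and stops on the first output cell.\<close>

lemma runs_last_round:
  assumes D: "decodes D" and c: "True \<notin> set (counter gs)"
  obtains h ls where "runs D (work_conf gs out) (conf Done h ls (map Digit out))"
proof -
  let ?gs = "sweep False False gs"
  obtain k l where 1: "runs D (work_conf gs out)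
      (conf (Counter k l False) (3 * int (length gs))
        (map Digit (rev (cells ?gs)) @ [Blank]) (Blank # map Digit out))"
    using runs_sweep [OF D, of False False False 0 "[Blank]" gs "Blank # map Digit out"] c
    unfolding work_conf_def by auto
  have 2: "runs D (conf (Counter k l False) (3 * int (length gs))
        (map Digit (rev (cells ?gs)) @ [Blank]) (Blank # map Digit out))
      (conf Done (3 * int (length gs) + 1)
        (Blank # map Digit (rev (cells ?gs)) @ [Blank]) (map Digit out))"
    by (intro runs_right [OF D transition.simps(4)]) simp
  show ?thesis by (rule that [OF rtranclp_trans [OF 1 2]])
qed

lemma halted_Done:
  assumes "decodes D"
  shows "halted D (conf Done h ls rs)"
proof -
  have "transition Done s = None" for s by (cases s) simp_all
  then show ?thesis
    using assms unfolding decodes_def conf_def halted.simps by (simp only: option.map)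
qed

lemma tape_output_conf: "tape_output (conf q h ls (map Digit out)) = out"
proof -
  have t: "tape h ls (map Digit out) (h + int i) = cell (map Digit out) i" for i
    by (simp add: tape_def)
  have "(LEAST n. cell (map Digit out) n \<notin> range Digit) = length out"
  proof (rule Least_equality)
    show "cell (map Digit out) (length out) \<notin> range Digit" by (auto simp: cell_def)
    show "length out \<le> n" if "cell (map Digit out) n \<notin> range Digit" for n
      using that by (cases "n < length out") (simp_all add: cell_def)
  qed
  then show ?thesis
    by (auto simp: conf_def t cell_def intro!: nth_equalityI)
qed

text \<open>The separator and the blank on the left are already present on the initial tape, so the
  input needs no preparation.\<close>

lemma initial_cells: "initial (cells gs) = work_conf gs []"
proof -
  have "conf (Counter False False False) 0 [Blank] (map Digit (cells gs) @ [Blank])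
      = conf (Counter False False False) 0 [] (map Digit (cells gs) @ [Blank])"
    by (rule conf_Blank)
  then show ?thesis
    by (auto simp: initial_def work_conf_def conf_def fun_eq_iff tape_def cell_def nth_append
        nat_less_iff)
qed

section \<open>Binary arithmetic of the register\<close>

fun bits_value :: "bool list \<Rightarrow> nat" where
  "bits_value [] = 0"
| "bits_value (b # bs) = of_bool b + 2 * bits_value bs"

lemma bits_value_surj:
  "n < 2 ^ L \<Longrightarrow> \<exists>bs. length bs = L \<and> bits_value bs = n"
proof (induction L arbitrary: n)
  case (Suc L)
  then have "n div 2 < 2 ^ L" by auto
  then obtain bs where "length bs = L" "bits_value bs = n div 2" using Suc.IH by blast
  then show ?case by (intro exI [of _ "odd n # bs"]) (auto simp: of_bool_odd_eq_mod_2)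
qed simp

lemma bits_value_pos: "True \<in> set bs \<longleftrightarrow> bits_value bs > 0"
  by (induction bs) auto

lemma last_bits_value:
  "bs \<noteq> [] \<Longrightarrow> last bs \<longleftrightarrow> 2 ^ (length bs - 1) \<le> bits_value bs"
proof (induction bs)
  case (Cons b bs)
  show ?case
  proof (cases "bs = []")
    case False
    then obtain m where m: "length bs = Suc m" by (cases bs) auto
    have "2 * 2 ^ m \<le> of_bool b + 2 * bits_value bs \<longleftrightarrow> 2 ^ m \<le> bits_value bs"
      by (cases b) (simp_all, presburger)
    then show ?thesis using Cons False m by simp
  qed simp
qed simp

lemma increment_sweep: "increment (sweep k nb gs) = increment gs"
  by (induction k nb gs rule: sweep.induct) (auto simp: register_defs)

text \<open>Unless \<open>nb\<close> holds, a borrow enters at the lowest digit; if all digits are 0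
  it runs through and leaves only ones.\<close>

lemma counter_sweep:
  "bits_value (counter (sweep k nb gs)) =
    (if nb then bits_value (counter gs)
     else if True \<in> set (counter gs) then bits_value (counter gs) - 1
     else 2 ^ length gs - 1)"
proof (induction k nb gs rule: sweep.induct)
  case (2 k nb c b a gs)
  have "bits_value (counter gs) > 0" if "True \<in> set (counter gs)"
    using that by (simp add: bits_value_pos)
  moreover have "Suc (2 * (v - Suc 0)) = 2 * v - Suc 0" if "v > 0" for v
    using that by linarith
  ultimately show ?case
    using "2.IH" by (cases nb; cases c) (auto simp: counter_def simp del: carry.simps parity.simps)
qed (simp add: counter_def)

text \<open>This is ripple-carry addition; losing the carry out of the top digit is reduction modulo
  \<open>2 ^ length gs\<close>.\<close>

lemma accumulator_sweep:
  "bits_value (accumulator (sweep k nb gs)) =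
    (bits_value (accumulator gs) + bits_value (increment gs) + of_bool k) mod 2 ^ length gs"
proof (induction k nb gs rule: sweep.induct)
  case (2 k nb c b a gs)
  define X where "X = bits_value (accumulator gs) + bits_value (increment gs) + of_bool (carry k b a)"
  have X: "(of_bool s + 2 * X) mod (2 * 2 ^ length gs) = of_bool s + 2 * (X mod 2 ^ length gs)" for s
    by (simp add: mod_mult2_eq)
  have digits: "of_bool a + of_bool b + of_bool k = of_bool (parity k b a) + 2 * (of_bool (carry k b a) :: nat)"
    by auto
  have "bits_value (accumulator (sweep k nb ((c, b, a) # gs))) =
      of_bool (parity k b a) + 2 * (X mod 2 ^ length gs)"
    using "2.IH" by (simp add: accumulator_def X_def del: parity.simps carry.simps)
  also have "\<dots> = (of_bool (parity k b a) + 2 * of_bool (carry k b a) +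
      2 * (bits_value (accumulator gs) + bits_value (increment gs))) mod (2 * 2 ^ length gs)"
    by (subst X [symmetric]) (simp only: X_def ac_simps distrib_left distrib_right)
  also have "\<dots> = (bits_value (accumulator ((c, b, a) # gs)) +
      bits_value (increment ((c, b, a) # gs)) + of_bool k) mod 2 ^ length ((c, b, a) # gs)"
    unfolding digits [symmetric] by (simp add: register_defs ac_simps)
  finally show ?case .
qed (simp add: register_defs)

text \<open>Induction on the counter, one digit per round. The factor \<open>j + 1\<close> appears
  because each round adds the increment before it emits.\<close>

lemma runs_rounds:
  assumes D: "decodes D" and "gs \<noteq> []"
    and "a = bits_value (accumulator gs)" and "b = bits_value (increment gs)"
    and "n = bits_value (counter gs)" and "L = length gs"
  shows "\<exists>h ls. runs D (work_conf gs out) (conf Done h ls (map Digit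
    (out @ map (\<lambda>j. 2 ^ (L - 1) \<le> (a + (j + 1) * b) mod 2 ^ L) [0..<n])))"
  using assms(2-)
proof (induction n arbitrary: gs out a)
  case 0
  then have "True \<notin> set (counter gs)" by (simp add: bits_value_pos)
  then show ?case using runs_last_round [OF D] by (metis append_Nil2 list.map(1) upt_0)
next
  case (Suc n)
  let ?gs = "sweep False False gs"
  let ?a = "(a + b) mod 2 ^ L"
  have c: "True \<in> set (counter gs)" using Suc.prems by (simp add: bits_value_pos)
  have ne: "?gs \<noteq> []" using Suc.prems by (metis length_0_conv length_sweep)
  have a: "?a = bits_value (accumulator ?gs)"
    using Suc.prems by (simp add: accumulator_sweep)
  have b: "b = bits_value (increment ?gs)"
    using Suc.prems by (simp add: increment_sweep)
  have n': "n = bits_value (counter ?gs)"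
    using Suc.prems(4) c by (simp add: counter_sweep)
  have L: "L = length ?gs"
    using Suc.prems by (simp add: length_sweep)
  have l: "last (accumulator ?gs) \<longleftrightarrow> 2 ^ (L - 1) \<le> ?a"
    using ne Suc.prems a
    by (subst last_bits_value) (simp_all add: accumulator_def length_sweep)
  obtain h ls where "runs D (work_conf ?gs (out @ [2 ^ (L - 1) \<le> ?a])) (conf Done h ls (map Digit
      ((out @ [2 ^ (L - 1) \<le> ?a]) @
        map (\<lambda>j. 2 ^ (L - 1) \<le> (?a + (j + 1) * b) mod 2 ^ L) [0..<n])))"
    using Suc.IH [OF ne a b n' L] by blast
  moreover have "(?a + (j + 1) * b) mod 2 ^ L = (a + (Suc j + 1) * b) mod 2 ^ L" for j
    by (simp only: mod_add_left_eq) (simp add: algebra_simps)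
  then have "(out @ [2 ^ (L - 1) \<le> ?a]) @
      map (\<lambda>j. 2 ^ (L - 1) \<le> (?a + (j + 1) * b) mod 2 ^ L) [0..<n] =
      out @ map (\<lambda>j. 2 ^ (L - 1) \<le> (a + (j + 1) * b) mod 2 ^ L) [0..<Suc n]"
    by (simp add: upt_conv_Cons map_Suc_upt [symmetric] o_def del: upt_Suc)
  ultimately have "runs D (work_conf ?gs (out @ [2 ^ (L - 1) \<le> ?a])) (conf Done h ls (map Digit
      (out @ map (\<lambda>j. 2 ^ (L - 1) \<le> (a + (j + 1) * b) mod 2 ^ L) [0..<Suc n])))"
    by (simp only:)
  then show ?case
    using rtranclp_trans [OF runs_round [OF D c Suc.prems(1), of out]] unfolding l by blast
qed

text \<open>The program interleaves the expansions of \<open>n\<close>, \<open>b\<close> and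
  \<open>a\<close>; their common width \<open>L\<close> makes delimiters unnecessary and gives the
  length \<open>3 * L\<close>.\<close>

lemma decoder:
  assumes "decodes D" and "L > 0" and "a < 2 ^ L" and "b < 2 ^ L" and "n < 2 ^ L"
  shows "\<exists>p. length p = 3 * L \<and> tm_fun D p =
    Some (map (\<lambda>j. 2 ^ (L - 1) \<le> (a + (j + 1) * b) mod 2 ^ L) [0..<n])"
proof -
  obtain as bs cs where "length as = L" "bits_value as = a" "length bs = L" "bits_value bs = b"
    "length cs = L" "bits_value cs = n"
    using assms bits_value_surj by metis
  moreover define gs where "gs = zip cs (zip bs as)"
  ultimately have gs: "length gs = L" "a = bits_value (accumulator gs)"
      "b = bits_value (increment gs)" "n = bits_value (counter gs)"
    by (simp_all add: register_defs flip: map_map)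
  then have "gs \<noteq> []" using assms(2) by auto
  then obtain h ls where "runs D (work_conf gs []) (conf Done h ls (map Digit
      ([] @ map (\<lambda>j. 2 ^ (L - 1) \<le> (a + (j + 1) * b) mod 2 ^ L) [0..<n])))"
    using runs_rounds [OF assms(1) _ gs(2,3,4) gs(1) [symmetric]] by blast
  then have "while_option (\<lambda>c. \<not> halted D c) (step D) (initial (cells gs)) = Some (conf Done h ls
      (map Digit (map (\<lambda>j. 2 ^ (L - 1) \<le> (a + (j + 1) * b) mod 2 ^ L) [0..<n])))"
    unfolding initial_cells append_Nil by (rule runs_while_option) (rule halted_Done [OF assms(1)])
  then have "tm_fun D (cells gs) =
      Some (map (\<lambda>j. 2 ^ (L - 1) \<le> (a + (j + 1) * b) mod 2 ^ L) [0..<n])"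
    by (simp only: tm_fun_def tape_output_conf option.map)
  then show ?thesis using gs(1) length_cells by blast
qed

section \<open>Information content\<close>

text \<open>The invariance theorem: simulating \<open>D\<close> on \<open>U\<close> costs only a
  prefix whose length is independent of the program.\<close>

lemma AIC_string_le:
  assumes "computable_enumeration M" and "universal M U"
  obtains C where "\<And>p s. tm_fun D p = Some s \<Longrightarrow> AIC_string U s \<le> enat (C + length p)"
proof -
  have "D \<in> M ` {1..}" using assms(1) by (simp add: computable_enumeration_def)
  then obtain n where n: "n \<ge> 1" "D = M n" by auto
  show ?thesis
  proof
    fix p s assume "tm_fun D p = Some s"
    then have "tm_fun U (hat (nth_string n) @ p) = Some s"
      using assms(2) n by (simp add: universal_def)
    then show "AIC_string U s \<le> enat (length (hat (nth_string n)) + length p)"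
      unfolding AIC_string_def by (intro INF_lower2 [of "hat (nth_string n) @ p"]) auto
  qed
qed

text \<open>Content 0 means that the empty program prints the string. It prints at most one string,
  and the \<open>w n\<close> have distinct lengths.\<close>

lemma eventually_AIC_string_pos:
  assumes "\<And>n. length (w n) = n"
  shows "\<forall>\<^sub>F n in sequentially. 1 \<le> AIC_string U (w n)"
proof -
  have *: "tm_fun U [] = Some (w n)" if "\<not> 1 \<le> AIC_string U (w n)" for n
    using that by (auto simp: AIC_string_def not_le INF_less_iff one_enat_def)
  show ?thesis
  proof (cases "tm_fun U []")
    case None
    then show ?thesis using * by (intro always_eventually) force
  next
    case (Some s)
    then have "1 \<le> AIC_string U (w n)" if "n > length s" for n
      using * [of n] that assms [of n] by force
    then show ?thesis by (auto intro: eventually_mono [OF eventually_gt_at_top])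
  qed
qed

lemma approx_seq_1I:
  fixes s :: "nat \<Rightarrow> enat" and A B :: real
  assumes le: "\<And>n. s n = enat (k n)" "\<And>n. real (k n) \<le> A + B * log 2 (real n + 1)"
    and pos: "\<forall>\<^sub>F n in sequentially. 1 \<le> s n"
  shows "approx_seq (\<lambda>n. ereal_of_enat (s n)) (\<lambda>n. ereal 1)"
  unfolding approx_seq_def
proof (intro allI impI conjI)
  fix \<epsilon> :: real assume \<epsilon>: "\<epsilon> > 0"
  have nz: "\<forall>\<^sub>F n in sequentially. real n powr \<epsilon> \<noteq> 0"
    by (rule eventually_mono [OF eventually_gt_at_top [of 0]]) simp
  have "(\<lambda>n. real (k n)) \<in> O(\<lambda>n. A + B * log 2 (real n + 1))"
  proof (intro bigoI [of _ 1] always_eventually allI)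
    fix n show "norm (real (k n)) \<le> 1 * norm (A + B * log 2 (real n + 1))"
      using le(2) [of n] by simp
  qed
  moreover have "(\<lambda>n::nat. A + B * log 2 (real n + 1)) \<in> o(\<lambda>n. real n powr \<epsilon>)"
  proof (rule sum_in_smallo)
    show "(\<lambda>n::nat. A) \<in> o(\<lambda>n. real n powr \<epsilon>)"
      using \<epsilon> by real_asymp
    have "(\<lambda>n::nat. log 2 (real n + 1)) \<in> o(\<lambda>n. real n powr \<epsilon>)"
      using \<epsilon> by real_asymp
    then show "(\<lambda>n::nat. B * log 2 (real n + 1)) \<in> o(\<lambda>n. real n powr \<epsilon>)"
      by simp
  qed
  ultimately have "(\<lambda>n. real (k n)) \<in> o(\<lambda>n. real n powr \<epsilon>)"
    by (rule landau_o.big_small_trans)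
  then show "little_o (\<lambda>n. ereal_of_enat (s n) / ereal 1) (\<lambda>n. real n powr \<epsilon>)"
    using little_o_ereal_iff [OF nz] by (simp add: le(1))
  \<comment> \<open>If \<open>k n = 0\<close>, the real quotient is 0 and the bound still
    holds.\<close>
  have "(\<lambda>n. 1 / real (k n)) \<in> O(\<lambda>n. 1)"
  proof (intro bigoI [of _ 1] always_eventually allI)
    fix n show "norm (1 / real (k n)) \<le> 1 * norm (1::real)"
      by (cases "k n = 0") auto
  qed
  moreover have "(\<lambda>n. 1) \<in> o(\<lambda>n. real n powr \<epsilon>)"
    using \<epsilon> by real_asymp
  ultimately have "(\<lambda>n. 1 / real (k n)) \<in> o(\<lambda>n. real n powr \<epsilon>)"
    by (rule landau_o.big_small_trans)
  then have "little_o (\<lambda>n. ereal (1 / real (k n))) (\<lambda>n. real n powr \<epsilon>)"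
    by (simp only: little_o_ereal_iff [OF nz])
  \<comment> \<open>Real and extended real division differ at 0, so the quotients are compared only
    where \<open>s n\<close> is at least 1.\<close>
  moreover have "\<forall>\<^sub>F n in sequentially. ereal (1 / real (k n)) / ereal (real n powr \<epsilon>) =
      ereal 1 / ereal_of_enat (s n) / ereal (real n powr \<epsilon>)"
    using pos by eventually_elim (simp add: le(1) one_enat_def)
  ultimately show "little_o (\<lambda>n. ereal 1 / ereal_of_enat (s n)) (\<lambda>n. real n powr \<epsilon>)"
    unfolding little_o_def using tendsto_cong by fast
qed

section \<open>Itineraries of the rotation\<close>

text \<open>Each reduction modulo 1 subtracts an integer, which the ceiling absorbs. At
  \<open>j = 0\<close> the point must already lie in \<open>(0, 1]\<close>.\<close>

lemma rotation_funpow: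
  assumes "x \<in> {0<..1}"
  shows "(rotation \<alpha> ^^ j) x = x + real j * \<alpha> - of_int \<lceil>x + real j * \<alpha>\<rceil> + 1"
proof (induction j)
  case 0
  have "\<lceil>x\<rceil> = 1" using assms by (simp add: ceiling_eq_iff)
  then show ?case by simp
next
  case (Suc j)
  let ?z = "x + real j * \<alpha>"
  have "?z - of_int \<lceil>?z\<rceil> + 1 + \<alpha> = ?z + \<alpha> - of_int (\<lceil>?z\<rceil> - 1)" by simp
  then have "\<lceil>?z - of_int \<lceil>?z\<rceil> + 1 + \<alpha>\<rceil> = \<lceil>?z + \<alpha>\<rceil> - (\<lceil>?z\<rceil> - 1)"
    by (simp only: ceiling_diff_of_int)
  moreover have "x + real (Suc j) * \<alpha> = ?z + \<alpha>" by (simp add: algebra_simps)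
  ultimately show ?case
    unfolding funpow.simps comp_apply Suc.IH by (simp add: rotation_def add.assoc)
qed

lemma itinerary_rotation:
  assumes "x \<in> {0<..1}"
  shows "itinerary (rotation \<alpha>) halves x j \<longleftrightarrow>
    1 / 2 < x + real j * \<alpha> - of_int \<lceil>x + real j * \<alpha>\<rceil> + 1"
proof -
  define y where "y = x + real j * \<alpha> - of_int \<lceil>x + real j * \<alpha>\<rceil> + 1"
  have "y > 0" "y \<le> 1" unfolding y_def by linarith+
  then have "y \<in> halves b \<longleftrightarrow> b = (1 / 2 < y)" for b
    by (auto simp: halves_def)
  then show ?thesis
    unfolding itinerary_def rotation_funpow [OF assms] y_def by simp
qed

section \<open>Rounding to dyadic numbers\<close>

text \<open>\<open>P / 2 ^ L\<close> is \<open>z\<close> up to an integer and an error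
  \<open>e\<close> smaller than the distance of \<open>z\<close> to the half-integers. Rounding thus
  crosses no endpoint, and the conventions at endpoints do not matter.\<close>

lemma top_bit_iff:
  fixes P L :: nat and z e :: real and m :: int
  assumes L: "L > 0" and P: "real P = 2 ^ L * (z + of_int m - e)" and e: "e \<ge> 0"
    and far: "\<And>k. 2 * e < \<bar>2 * z - of_int k\<bar>"
  shows "2 ^ (L - 1) \<le> P mod 2 ^ L \<longleftrightarrow> 1 / 2 < z - of_int \<lceil>z\<rceil> + 1"
proof -
  define f where "f = z - of_int \<lceil>z\<rceil> + 1"
  define r where "r = int P - 2 ^ L * (m + \<lceil>z\<rceil> - 1)"
  have f: "0 < f" "f \<le> 1" unfolding f_def by linarith+
  \<comment> \<open>The next three facts keep \<open>f\<close> away from 0, 1/2 and 1, the endpoints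
    of the two arcs.\<close>
  have f0: "2 * e < \<bar>2 * f\<bar>"
    using far [of "2 * (\<lceil>z\<rceil> - 1)"] by (simp add: f_def algebra_simps)
  have f1: "2 * e < \<bar>2 * f - 1\<bar>"
    using far [of "2 * (\<lceil>z\<rceil> - 1) + 1"] by (simp add: f_def algebra_simps)
  have f2: "2 * e < \<bar>2 * f - 2\<bar>"
    using far [of "2 * (\<lceil>z\<rceil> - 1) + 2"] by (simp add: f_def algebra_simps)
  have r: "real_of_int r = 2 ^ L * (f - e)"
    using P by (simp add: r_def f_def algebra_simps)
  have "0 < f - e" "f - e < 1" using f f0 f2 e by linarith+
  then have "0 \<le> real_of_int r" "real_of_int r < 2 ^ L" unfolding r by simp_all
  then have r': "0 \<le> r" "r < 2 ^ L" by (simp, metis of_int_less_iff of_int_numeral of_int_power)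
  have "int P = r + 2 ^ L * (m + \<lceil>z\<rceil> - 1)" by (simp add: r_def)
  then have "int P mod 2 ^ L = r mod 2 ^ L" by simp
  then have "int (P mod 2 ^ L) = r" using r' by (simp add: zmod_int)
  then have "2 ^ (L - 1) \<le> P mod 2 ^ L \<longleftrightarrow> 2 ^ (L - 1) \<le> r"
    by (metis of_nat_le_iff of_nat_numeral of_nat_power)
  also have "\<dots> \<longleftrightarrow> (2::real) ^ (L - 1) \<le> 2 ^ L * (f - e)"
    unfolding r [symmetric] by (metis of_int_le_iff of_int_numeral of_int_power)
  also have "\<dots> \<longleftrightarrow> (2::real) ^ (L - 1) * 1 \<le> 2 ^ (L - 1) * (2 * (f - e))"
    using L by (cases L) (simp_all add: mult_ac)
  also have "\<dots> \<longleftrightarrow> 1 / 2 \<le> f - e"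
    by (subst mult_le_cancel_left_pos) auto
  also have "\<dots> \<longleftrightarrow> 1 / 2 < f"
    using f1 e by linarith
  finally show ?thesis by (simp only: f_def)
qed

text \<open>Take for \<open>a\<close> and \<open>b\<close> the first \<open>L\<close> bits of the
  fractional parts of \<open>x - \<alpha>\<close> and \<open>\<alpha>\<close>. The shift by
  \<open>\<alpha>\<close> compensates for the addition before the first output digit.\<close>

lemma itinerary_dyadic:
  fixes x \<alpha> c :: real and n L :: nat
  assumes x: "x \<in> {0<..1}"
    and far: "\<And>j k. c / (real j + 1)\<^sup>2 \<le> \<bar>2 * (x + real j * \<alpha>) - of_int k\<bar>"
    and L: "L > 0" "2 * (real n + 1) ^ 3 < c * 2 ^ L"
  obtains a b where "a < 2 ^ L" "b < 2 ^ L"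
    "map (\<lambda>j. 2 ^ (L - 1) \<le> (a + (j + 1) * b) mod 2 ^ L) [0..<n] =
      map (itinerary (rotation \<alpha>) halves x) [0..<n]"
proof -
  define num where "num = (\<lambda>y::real. nat \<lfloor>2 ^ L * frac y\<rfloor>)"
  have num_less: "num y < 2 ^ L" for y :: real
  proof -
    have "2 ^ L * frac y < 2 ^ L" by (simp add: frac_lt_1)
    then have "\<lfloor>2 ^ L * frac y\<rfloor> < 2 ^ L" by (simp add: floor_less_iff)
    then show ?thesis by (simp add: num_def nat_less_iff)
  qed
  have num: "real (num y) \<le> 2 ^ L * frac y" "2 ^ L * frac y < real (num y) + 1" for y :: real
  proof -
    have "real (num y) = of_int \<lfloor>2 ^ L * frac y\<rfloor>" by (simp add: num_def)
    then show "real (num y) \<le> 2 ^ L * frac y" "2 ^ L * frac y < real (num y) + 1" by linarith+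
  qed
  show ?thesis
  proof (rule that [OF num_less num_less])
    show "map (\<lambda>j. 2 ^ (L - 1) \<le> (num (x - \<alpha>) + (j + 1) * num \<alpha>) mod 2 ^ L) [0..<n] =
      map (itinerary (rotation \<alpha>) halves x) [0..<n]"
    proof (intro map_cong refl)
      fix j assume "j \<in> set [0..<n]"
      then have j: "real j + 1 \<le> real n" by auto
      \<comment> \<open>The total error: one rounding of \<open>x - \<alpha>\<close> and
        \<open>j + 1\<close> copies of the rounding of \<open>\<alpha>\<close>.\<close>
      define e where "e = (2 ^ L * frac (x - \<alpha>) - real (num (x - \<alpha>)) +
        (real j + 1) * (2 ^ L * frac \<alpha> - real (num \<alpha>))) / 2 ^ L"
      let ?m = "- \<lfloor>x - \<alpha>\<rfloor> - (int j + 1) * \<lfloor>\<alpha>\<rfloor>"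
      have "e \<ge> 0"
        unfolding e_def using num by (intro divide_nonneg_pos add_nonneg_nonneg mult_nonneg_nonneg) simp_all
      define d where "d = 2 ^ L * frac \<alpha> - real (num \<alpha>)"
      have "(real j + 1) * d \<le> (real j + 1) * 1"
        using num(2) [of \<alpha>] by (intro mult_left_mono) (auto simp: d_def)
      moreover have "2 ^ L * e = 2 ^ L * frac (x - \<alpha>) - real (num (x - \<alpha>)) + (real j + 1) * d"
        by (simp add: e_def d_def)
      moreover have "2 ^ L * frac (x - \<alpha>) - real (num (x - \<alpha>)) \<le> 1"
        using num(2) [of "x - \<alpha>"] by simp
      ultimately have "2 ^ L * e \<le> 1 + (real j + 1) * 1"
        by (simp only: add_mono)
      then have "2 ^ L * e \<le> real j + 2" by simp
      \<comment> \<open>The error contributes one factor \<open>n + 1\<close> and the required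
        distance two, whence the cube in the hypothesis on \<open>L\<close>.\<close>
      then have "2 ^ L * e * (real j + 1)\<^sup>2 \<le> (real n + 1) * (real n + 1)\<^sup>2"
        using j by (intro mult_mono power_mono) auto
      then have "2 ^ L * (2 * e * (real j + 1)\<^sup>2) < 2 ^ L * c"
        using L(2) by (simp add: power3_eq_cube power2_eq_square algebra_simps)
      then have "2 * e < c / (real j + 1)\<^sup>2"
        by (simp add: field_simps)
      then have "2 * e < \<bar>2 * (x + real j * \<alpha>) - of_int k\<bar>" for k
        using far [of j k] by linarith
      moreover have "real (num (x - \<alpha>) + (j + 1) * num \<alpha>) =
          2 ^ L * (x + real j * \<alpha> + of_int ?m - e)"
        by (simp add: e_def frac_def field_simps)
      ultimately show "2 ^ (L - 1) \<le> (num (x - \<alpha>) + (j + 1) * num \<alpha>) mod 2 ^ L \<longleftrightarrow>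
          itinerary (rotation \<alpha>) halves x j"
        using itinerary_rotation [OF x] top_bit_iff [OF L(1) _ \<open>e \<ge> 0\<close>] by metis
    qed
  qed
qed

section \<open>Distance of almost every orbit from the endpoints\<close>

lemma nonint_far_from_Ints:
  fixes y :: real
  assumes "y \<notin> \<int>"
  shows "\<exists>d>0. \<forall>k. d \<le> \<bar>y - of_int k\<bar>"
proof (intro exI conjI allI)
  show "min (frac y) (1 - frac y) > 0"
    using assms frac_lt_1 [of y] frac_gt_0_iff [of y] by simp
  fix k
  show "min (frac y) (1 - frac y) \<le> \<bar>y - of_int k\<bar>"
  proof (cases "k \<le> \<lfloor>y\<rfloor>")
    case True
    then have "real_of_int k \<le> of_int \<lfloor>y\<rfloor>" by simp
    then show ?thesis unfolding frac_def by linarith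
  next
    case False
    then have "real_of_int k \<ge> of_int \<lfloor>y\<rfloor> + 1" by linarith
    then show ?thesis unfolding frac_def by linarith
  qed
qed

text \<open>The exceptional sets have measure at most \<open>6 / (j + 1)\<^sup>2\<close>, which is
  summable, so Borel-Cantelli leaves finitely many \<open>j\<close>. These are handled by shrinking
  \<open>c\<close>, off the countable set of \<open>x\<close> whose orbit hits an endpoint.\<close>

lemma rotation_far_from_halves:
  fixes \<alpha> :: real
  shows "AE x in lborel. x \<in> {0<..1} \<longrightarrow>
    (\<exists>c>0. \<forall>j k. c / (real j + 1)\<^sup>2 \<le> \<bar>2 * (x + real j * \<alpha>) - of_int k\<bar>)"
proof -
  define r where "r = (\<lambda>j::nat. 1 / (real j + 1)\<^sup>2)"
  \<comment> \<open>Since \<open>0 < 2 * x \<le> 2\<close> and \<open>r j \<le> 1\<close>, only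
    these six integers can be within \<open>r j\<close> of the orbit point times 2.\<close>
  define K where "K = (\<lambda>j::nat. {\<lfloor>2 * (real j * \<alpha>)\<rfloor> - 1 .. \<lfloor>2 * (real j * \<alpha>)\<rfloor> + 4})"
  define I where "I = (\<lambda>j k. {(real_of_int k - r j) / 2 - real j * \<alpha> .. (of_int k + r j) / 2 - real j * \<alpha>})"
  define B where "B = (\<lambda>j. \<Union>k\<in>K j. I j k)"
  have r: "0 < r j" "r j \<le> 1" for j
    by (simp_all add: r_def divide_le_eq one_le_power)
  have I: "emeasure lborel (I j k) = ennreal (r j)" for j k
  proof -
    have "(of_int k + r j) / 2 - real j * \<alpha> - ((of_int k - r j) / 2 - real j * \<alpha>) = r j"
      by (simp add: diff_divide_distrib add_divide_distrib)
    moreover have "(of_int k - r j) / 2 - real j * \<alpha> \<le> (of_int k + r j) / 2 - real j * \<alpha>"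
      using r [of j] by simp
    ultimately show ?thesis by (simp only: I_def emeasure_lborel_Icc)
  qed
  have B_sets: "B j \<in> sets lborel" for j by (simp add: B_def I_def K_def)
  have B_le: "emeasure lborel (B j) \<le> ennreal (6 * r j)" for j
  proof -
    have "emeasure lborel (B j) \<le> (\<Sum>k\<in>K j. emeasure lborel (I j k))"
      unfolding B_def
      by (rule emeasure_subadditive_finite) (simp_all add: K_def I_def image_subset_iff)
    also have "\<dots> = of_nat (card (K j)) * ennreal (r j)"
      by (simp only: I sum_constant)
    also have "card (K j) = 6"
      unfolding K_def card_atLeastAtMost_int by linarith
    also have "of_nat 6 * ennreal (r j) = ennreal (6 * r j)"
      using r [of j] by (subst ennreal_mult) simp_all
    finally show ?thesis .
  qed
  have le: "measure lborel (B j) \<le> 6 * r j" for j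
    unfolding measure_def using B_le [of j] r [of j] by (intro enn2real_leI) auto
  have "summable (\<lambda>j. 6 * r j)"
  proof (intro summable_mult)
    have "summable (\<lambda>j. inverse (real (Suc j) ^ 2))"
      by (subst summable_Suc_iff) (rule inverse_power_summable, simp)
    then show "summable r" by (simp add: r_def inverse_eq_divide add.commute)
  qed
  then have "summable (\<lambda>j. measure lborel (B j))"
    by (rule summable_comparison_test' [where N = 0]) (simp add: le)
  then have "AE x in lborel. \<forall>\<^sub>F j in sequentially. x \<in> space lborel - B j"
    using le_less_trans [OF B_le ennreal_less_top] by (intro borel_cantelli_AE1 B_sets) auto
  moreover have "AE x in lborel. \<forall>j::nat. \<forall>k::int. x \<noteq> of_int k / 2 - real j * \<alpha>"
    unfolding AE_all_countable by (intro allI AE_lborel_singleton)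
  ultimately show ?thesis
  proof eventually_elim
    case (elim x)
    show ?case
    proof
      assume "x \<in> {0<..1}"
      then have x01: "0 < x" "x \<le> 1" by simp_all
      obtain J where J: "\<And>j. j \<ge> J \<Longrightarrow> x \<notin> B j"
        using elim(1) by (auto simp: eventually_sequentially)
      have far: "r j \<le> \<bar>2 * (x + real j * \<alpha>) - of_int k\<bar>" if "j \<ge> J" for j k
      proof (rule ccontr)
        define y where "y = real j * \<alpha>"
        assume "\<not> ?thesis"
        then have *: "2 * x + 2 * y - of_int k < r j" "of_int k - (2 * x + 2 * y) < r j"
          by (simp_all add: y_def abs_less_iff)
        have "(of_int k - r j) / 2 - y \<le> x" "x \<le> (of_int k + r j) / 2 - y"
          using * by (simp_all add: field_simps)
        then have xI: "x \<in> I j k" by (simp add: I_def y_def)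
        have "real_of_int (\<lfloor>2 * y\<rfloor> - 1) < of_int k" "real_of_int k < of_int (\<lfloor>2 * y\<rfloor> + 4)"
          using * x01 r(2) [of j] unfolding of_int_diff of_int_add of_int_numeral of_int_1 by linarith+
        then have "\<lfloor>2 * y\<rfloor> - 1 \<le> k" "k \<le> \<lfloor>2 * y\<rfloor> + 4"
          unfolding of_int_less_iff by simp_all
        then have "k \<in> K j" by (simp add: K_def y_def)
        with xI show False using J [OF that] by (auto simp: B_def)
      qed
      \<comment> \<open>The bound \<open>c \<le> 1\<close> ensures that scaling by \<open>c\<close>
        also preserves the estimate for \<open>j \<ge> J\<close>.\<close>
      have early: "\<exists>c>0. c \<le> 1 \<and> (\<forall>j<J. \<forall>k. c \<le> \<bar>2 * (x + real j * \<alpha>) - of_int k\<bar>)" for J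
      proof (induction J)
        case (Suc J)
        then obtain c where c: "c > 0" "c \<le> 1" "\<forall>j<J. \<forall>k. c \<le> \<bar>2 * (x + real j * \<alpha>) - of_int k\<bar>"
          by blast
        have "2 * (x + real J * \<alpha>) \<notin> \<int>"
        proof
          assume "2 * (x + real J * \<alpha>) \<in> \<int>"
          then obtain k where "2 * (x + real J * \<alpha>) = of_int k" by (auto elim: Ints_cases)
          then show False using elim(2) by (simp add: field_simps)
        qed
        then obtain d where d: "d > 0" "\<forall>k. d \<le> \<bar>2 * (x + real J * \<alpha>) - of_int k\<bar>"
          using nonint_far_from_Ints by metis
        have "min c d \<le> \<bar>2 * (x + real j * \<alpha>) - of_int k\<bar>" if "j < Suc J" for j k
          using that c(3) d(2) by (cases "j = J") (simp_all add: less_Suc_eq min.coboundedI1 min.coboundedI2)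
        then show ?case using c(1,2) d(1) by (intro exI [of _ "min c d"]) simp
      next
        case 0
        show ?case by (rule exI [of _ 1]) simp
      qed
      obtain c where c: "c > 0" "c \<le> 1"
        "\<And>j k. j < J \<Longrightarrow> c \<le> \<bar>2 * (x + real j * \<alpha>) - of_int k\<bar>"
        using early [of J] by auto
      have "c * r j \<le> \<bar>2 * (x + real j * \<alpha>) - of_int k\<bar>" for j k
      proof (cases "j < J")
        case True
        have "c * r j \<le> c * 1" using c r [of j] by (intro mult_left_mono) auto
        then show ?thesis using c(3) [OF True, of k] by linarith
      next
        case False
        have "c * r j \<le> 1 * r j" using c r [of j] by (intro mult_right_mono) auto
        then show ?thesis using far [of j k] False by simp
      qed
      then show "\<exists>c>0. \<forall>j k. c / (real j + 1)\<^sup>2 \<le> \<bar>2 * (x + real j * \<alpha>) - of_int k\<bar>"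
        using c(1) by (intro exI [of _ c]) (simp add: r_def)
    qed
  qed
qed

section \<open>The logarithmic bound\<close>

lemma AIC_rotation_approx_1:
  fixes x \<alpha> c :: real
  assumes M: "computable_enumeration M" "universal M U"
    and x: "x \<in> {0<..1}" and "c > 0"
    and far: "\<And>j k. c / (real j + 1)\<^sup>2 \<le> \<bar>2 * (x + real j * \<alpha>) - of_int k\<bar>"
  shows "approx_seq (\<lambda>n. ereal_of_enat (AIC U (rotation \<alpha>) halves x n)) (\<lambda>n. ereal 1)"
proof -
  define w where "w = (\<lambda>n. map (itinerary (rotation \<alpha>) halves x) [0..<n])"
  obtain D where D: "decodes D" using decodes_ex by blast
  obtain C where C: "\<And>p s. tm_fun D p = Some s \<Longrightarrow> AIC_string U s \<le> enat (C + length p)"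
    using AIC_string_le [OF M] by blast
  obtain K where K: "2 / c < 2 ^ K" using real_arch_pow [of 2 "2 / c"] by auto
  define m where "m = (\<lambda>n::nat. nat \<lceil>log 2 (real n + 1)\<rceil>)"
  \<comment> \<open>\<open>3 * m n\<close> bits pay for \<open>(n + 1) ^ 3\<close> and
    \<open>K\<close> bits for the factor \<open>2 / c\<close>; the last bit makes \<open>L n\<close>
    positive.\<close>
  define L where "L = (\<lambda>n. K + 3 * m n + 1)"
  have m: "real (m n) \<le> log 2 (real n + 1) + 1" "real n + 1 \<le> 2 ^ m n" for n
  proof -
    have "0 \<le> log 2 (real n + 1)" by simp
    then have rm: "real (m n) = of_int \<lceil>log 2 (real n + 1)\<rceil>" by (simp add: m_def)
    then show "real (m n) \<le> log 2 (real n + 1) + 1" by linarith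
    have "real n + 1 = 2 powr log 2 (real n + 1)" by simp
    also have "\<dots> \<le> 2 powr real (m n)" unfolding rm by (intro powr_mono) simp_all
    finally show "real n + 1 \<le> 2 ^ m n" by (simp add: powr_realpow)
  qed
  have "AIC_string U (w n) \<le> enat (C + 3 * L n)" for n
  proof -
    have "(2::real) ^ m n \<le> 2 ^ L n" by (rule power_increasing) (simp_all add: L_def)
    then have "real n < 2 ^ L n" using m(2) [of n] by linarith
    then have n: "n < 2 ^ L n" by (metis of_nat_less_iff of_nat_numeral of_nat_power)
    have "(real n + 1) ^ 3 \<le> (2 ^ m n) ^ 3" using m(2) by (intro power_mono) simp_all
    then have "2 * (real n + 1) ^ 3 \<le> 2 * 2 ^ (3 * m n)" by (simp add: power_mult mult.commute)
    also have "\<dots> < (c * 2 ^ K) * 2 ^ (3 * m n)"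
      using K \<open>c > 0\<close> by (intro mult_strict_right_mono) (simp_all add: field_simps)
    also have "\<dots> \<le> c * 2 ^ L n" using \<open>c > 0\<close> by (simp add: L_def power_add)
    finally have "2 * (real n + 1) ^ 3 < c * 2 ^ L n" .
    moreover have L: "L n > 0" by (simp add: L_def)
    ultimately obtain a b where ab: "a < 2 ^ L n" "b < 2 ^ L n"
      "map (\<lambda>j. 2 ^ (L n - 1) \<le> (a + (j + 1) * b) mod 2 ^ L n) [0..<n] = w n"
      using itinerary_dyadic [OF x far L] unfolding w_def by blast
    then obtain p where "length p = 3 * L n" "tm_fun D p = Some (w n)"
      using decoder [OF D L ab(1,2) n] unfolding ab(3) by blast
    then show ?thesis using C [of p "w n"] by simp
  qed
  then have "\<exists>k. AIC_string U (w n) = enat k \<and> k \<le> C + 3 * L n" for n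
    by (metis enat_ile enat_ord_simps(1))
  then obtain k where k: "\<And>n. AIC_string U (w n) = enat (k n)" "\<And>n. k n \<le> C + 3 * L n"
    by metis
  \<comment> \<open>\<open>3 * L n\<close> is \<open>3 * K + 9 * m n + 3\<close>, and rounding the
    logarithm up adds at most 9.\<close>
  have "real (k n) \<le> real (C + 3 * K + 12) + 9 * log 2 (real n + 1)" for n
  proof -
    have "real (k n) \<le> real (C + 3 * L n)" using k(2) by (simp only: of_nat_le_iff)
    then show ?thesis using m(1) [of n] by (simp add: L_def)
  qed
  moreover have "length (w n) = n" for n by (simp add: w_def)
  ultimately have "approx_seq (\<lambda>n. ereal_of_enat (AIC_string U (w n))) (\<lambda>n. ereal 1)"
    using k(1) by (intro approx_seq_1I eventually_AIC_string_pos)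
  then show ?thesis by (simp add: AIC_def w_def)
qed

theorem theorem10:
  fixes M :: "nat \<Rightarrow> tm" and U :: tm and \<alpha> :: real
  assumes "computable_enumeration M" and "universal M U" and "\<alpha> \<notin> \<rat>"
  shows "AE x in lebesgue_on {0<..1}.
    \<exists>c::real. c > 0 \<and>
      approx_seq (\<lambda>n. ereal_of_enat (AIC U (rotation \<alpha>) halves x n)) (\<lambda>n. ereal c)"
proof -
  \<comment> \<open>The almost-everywhere statement passes from Borel measure to its completion and
    then to the circle.\<close>
  have "AE x in lebesgue. x \<in> {0<..1} \<longrightarrow>
      (\<exists>c>0. \<forall>j k. c / (real j + 1)\<^sup>2 \<le> \<bar>2 * (x + real j * \<alpha>) - of_int k\<bar>)"
    by (rule AE_completion [OF rotation_far_from_halves])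
  then have "AE x in lebesgue_on {0<..1}.
      \<exists>c>0. \<forall>j k. c / (real j + 1)\<^sup>2 \<le> \<bar>2 * (x + real j * \<alpha>) - of_int k\<bar>"
    by (subst AE_restrict_space_iff) simp_all
  moreover have "AE x in lebesgue_on {0<..1}. x \<in> {0<..1::real}"
    using AE_space [of "lebesgue_on {0<..1::real}"] by (simp add: space_restrict_space)
  ultimately show ?thesis
  proof eventually_elim
    case (elim x)
    then show ?case
      using AIC_rotation_approx_1 [OF assms(1,2) elim(2)] by (intro exI [of _ 1]) auto
  qed
qed

end
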